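(* Let $H$ be any complex Hilbert space with $\dim H\ge 4$. Then there exists a triple $\mathcal T=(T_1,T_2,T_3)$ of mutually commuting bounded linear operators on $H$ such that the Asplund–Ptak numerical range $$W_{\rm AP}(\mathcal T)=\{(\langle T_1x,y\rangle,\langle T_2x,y\rangle,\langle T_3x,y\rangle): x,y\in H,\ \|x\|\le 1,\ \|y\|\le 1\}\subset\mathbb C^3$$ is not convex.
   Context: Mutually commuting means $T_jT_k=T_kT_j$ for all $j,k$. Convexity of a subset of $\mathbb C^n$ is the usual (real) convexity: $tu+(1-t)v$ belongs to the set whenever $u,v$ do and $t\in[0,1]$. *)

theory Defs
  imports "HOL-Analysis.Analysis" "HOL-Library.Extended_Nat"
begin

text \<open>
  Complex Hilbert spaces as a type class on top of \<^class>\<open>banach\<close>: the norm is the one induced by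
  the inner product and the real scalar multiplication is the restriction of the complex one.
  The inner product is linear in its first and conjugate-linear in its second argument.
\<close>

class chilbert_space = banach +
  fixes scaleC :: "complex \<Rightarrow> 'a \<Rightarrow> 'a"  (infixr \<open>*\<^sub>C\<close> 75)
    and cinner :: "'a \<Rightarrow> 'a \<Rightarrow> complex"
  assumes scaleC_add_right: "a *\<^sub>C (x + y) = a *\<^sub>C x + a *\<^sub>C y"
    and scaleC_add_left: "(a + b) *\<^sub>C x = a *\<^sub>C x + b *\<^sub>C x"
    and scaleC_scaleC: "a *\<^sub>C (b *\<^sub>C x) = (a * b) *\<^sub>C x"
    and scaleC_one: "1 *\<^sub>C x = x"
    and scaleR_scaleC: "r *\<^sub>R x = complex_of_real r *\<^sub>C x"
    and cinner_commute: "cinner x y = cnj (cinner y x)"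
    and cinner_add_left: "cinner (x + y) z = cinner x z + cinner y z"
    and cinner_scaleC_left: "cinner (a *\<^sub>C x) y = a * cinner x y"
    and cinner_ge_zero: "0 \<le> Re (cinner x x)"
    and cinner_eq_zero_iff: "cinner x x = 0 \<longleftrightarrow> x = 0"
    and norm_eq_sqrt_cinner: "norm x = sqrt (Re (cinner x x))"

global_interpretation complex_vector:
  vector_space "scaleC :: complex \<Rightarrow> 'a \<Rightarrow> 'a::chilbert_space"
  defines cspan = complex_vector.span
    and cdependent = complex_vector.dependent
    and cdim = complex_vector.dim
  by unfold_locales
    (simp_all add: scaleC_add_right scaleC_add_left scaleC_scaleC scaleC_one)

text \<open>
  The library dimension of an infinite-dimensional space is the junk value \<open>0\<close>;
  here it is \<open>\<infinity>\<close>.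
\<close>

definition cdimension :: "'a::chilbert_space itself \<Rightarrow> enat" where
  "cdimension _ =
     (if \<exists>B::'a set. finite B \<and> cspan B = UNIV then enat (cdim (UNIV :: 'a set)) else \<infinity>)"

definition bounded_clinear :: "('a::chilbert_space \<Rightarrow> 'a) \<Rightarrow> bool" where
  "bounded_clinear T \<longleftrightarrow>
     Vector_Spaces.linear scaleC scaleC T \<and> (\<exists>K. \<forall>x. norm (T x) \<le> K * norm x)"

text \<open>The Asplund--Ptak numerical range of a triple of operators.\<close>

definition AP_range ::
  "('a::chilbert_space \<Rightarrow> 'a) \<times> ('a \<Rightarrow> 'a) \<times> ('a \<Rightarrow> 'a) \<Rightarrow> (complex \<times> complex \<times> complex) set" where
  "AP_range = (\<lambda>(T1, T2, T3).
     {(cinner (T1 x) y, cinner (T2 x) y, cinner (T3 x) y) | x y. norm x \<le> 1 \<and> norm y \<le> 1})"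

end

theory Submission imports Defs begin

text \<open>
  Take orthonormal \<open>a, b, c, d\<close> and \<open>T\<^sub>1 = \<langle>\<cdot>,a\<rangle>c\<close>, \<open>T\<^sub>2 = \<langle>\<cdot>,b\<rangle>d\<close>, \<open>T\<^sub>3 = \<langle>\<cdot>,a\<rangle>d\<close>. All products
  \<open>T\<^sub>jT\<^sub>k\<close> vanish, and the numerical range consists of three of the entries of the rank-one matrices
  \<open>(x\<^sub>i y\<^sub>j)\<close>, where \<open>x\<^sub>1 = \<langle>x,a\<rangle>\<close>, \<open>x\<^sub>2 = \<langle>x,b\<rangle>\<close>, \<open>y\<^sub>1 = \<langle>c,y\<rangle>\<close>, \<open>y\<^sub>2 = \<langle>d,y\<rangle>\<close>. It
  contains \<open>(1,0,0)\<close> and \<open>(0,1,0)\<close>, but not their midpoint: if the off-diagonal entry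
  \<open>x\<^sub>1y\<^sub>2\<close> is zero, then so is one of the diagonal entries \<open>x\<^sub>1y\<^sub>1\<close>, \<open>x\<^sub>2y\<^sub>2\<close>.
\<close>

lemma cinner_zero_left: "cinner 0 (y::'a::chilbert_space) = 0"
  using cinner_add_left[of 0 0 y] by simp

lemma cinner_diff_left:
  "cinner (x - y) (z::'a::chilbert_space) = cinner x z - cinner y z"
  using cinner_add_left[of "x - y" y z] by simp

lemma cinner_diff_right:
  "cinner (z::'a::chilbert_space) (x - y) = cinner z x - cinner z y"
  by (subst (1 2 3) cinner_commute) (simp add: cinner_diff_left)

lemma cinner_scaleC_right:
  "cinner (x::'a::chilbert_space) (c *\<^sub>C y) = cnj c * cinner x y"
  by (subst (1 2) cinner_commute) (simp add: cinner_scaleC_left)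

lemma cinner_sum_left:
  "cinner (\<Sum>i\<in>I. f i) (y::'a::chilbert_space) = (\<Sum>i\<in>I. cinner (f i) y)"
  by (induction I rule: infinite_finite_induct) (simp_all add: cinner_zero_left cinner_add_left)

lemma cinner_self: "cinner x x = complex_of_real ((norm (x::'a::chilbert_space))\<^sup>2)"
proof (rule complex_eqI)
  show "Re (cinner x x) = Re (complex_of_real ((norm x)\<^sup>2))"
    by (simp add: norm_eq_sqrt_cinner cinner_ge_zero)
  have "Im (cinner x x) = - Im (cinner x x)"
    by (subst cinner_commute) simp
  then show "Im (cinner x x) = Im (complex_of_real ((norm x)\<^sup>2))"
    by simp
qed

text \<open>The normed space axioms give homogeneity for real scalars; for complex ones the squared
  norms are compared through the inner product.\<close>

lemma norm_scaleC: "norm (c *\<^sub>C (x::'a::chilbert_space)) = cmod c * norm x"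
proof -
  have "complex_of_real ((norm (c *\<^sub>C x))\<^sup>2) = complex_of_real ((cmod c * norm x)\<^sup>2)"
    unfolding cinner_self[of "c *\<^sub>C x", symmetric]
    by (simp add: cinner_scaleC_left cinner_scaleC_right cinner_self[of x] power_mult_distrib
        complex_norm_square[symmetric] mult.assoc[symmetric] mult.commute[of "cnj c" c])
  then show ?thesis
    by (simp only: of_real_eq_iff) simp
qed

text \<open>Subtracting from \<open>x\<close> its projection onto \<open>e\<close> leaves a vector
  of squared norm \<open>(norm x)\<^sup>2 - (cmod k)\<^sup>2\<close>, which cannot be
  negative.\<close>

lemma cmod_cinner_le_norm:
  fixes x e :: "'a::chilbert_space"
  assumes "norm e = 1"
  shows "cmod (cinner x e) \<le> norm x"
proof -
  define k where "k = cinner x e"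
  have ee: "cinner e e = 1"
    using assms by (simp add: cinner_self)
  have ex: "cinner e x = cnj k"
    unfolding k_def by (rule cinner_commute)
  have "complex_of_real ((norm (x - k *\<^sub>C e))\<^sup>2) = cinner x x - k * cnj k"
    unfolding cinner_self[of "x - k *\<^sub>C e", symmetric]
    by (simp add: cinner_diff_left cinner_diff_right cinner_scaleC_left
        cinner_scaleC_right ee ex k_def[symmetric] algebra_simps)
  also have "\<dots> = complex_of_real ((norm x)\<^sup>2 - (cmod k)\<^sup>2)"
    by (simp add: cinner_self complex_norm_square[symmetric])
  finally have "(norm (x - k *\<^sub>C e))\<^sup>2 = (norm x)\<^sup>2 - (cmod k)\<^sup>2"
    by (simp only: of_real_eq_iff)
  then have "(cmod k)\<^sup>2 \<le> (norm x)\<^sup>2"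
    using zero_le_power2[of "norm (x - k *\<^sub>C e)"] by linarith
  then show ?thesis
    unfolding k_def by (rule power2_le_imp_le) simp
qed

definition orthonormal :: "'a::chilbert_space set \<Rightarrow> bool" where
  "orthonormal S \<longleftrightarrow> (\<forall>u\<in>S. norm u = 1) \<and> (\<forall>u\<in>S. \<forall>v\<in>S. u \<noteq> v \<longrightarrow> cinner u v = 0)"

text \<open>One Gram-Schmidt step: remove from a vector outside the span its projection onto the
  span, then normalise.\<close>

lemma orthonormal_extend:
  fixes S :: "'a::chilbert_space set"
  assumes S: "orthonormal S" "finite S" and "cspan S \<noteq> UNIV"
  obtains e where "e \<notin> S" "orthonormal (insert e S)"
proof -
  obtain v where v: "v \<notin> cspan S"
    using assms by blast
  define w where "w = v - (\<Sum>s\<in>S. cinner v s *\<^sub>C s)"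
  define e where "e = complex_of_real (1 / norm w) *\<^sub>C w"
  have "(\<Sum>s\<in>S. cinner v s *\<^sub>C s) \<in> cspan S"
    by (intro complex_vector.span_sum complex_vector.span_scale complex_vector.span_base)
  then have "w \<noteq> 0"
    using v by (auto simp: w_def)
  then have ne: "norm e = 1"
    by (simp add: e_def norm_scaleC norm_divide)
  have "cinner w s = 0" if "s \<in> S" for s
  proof -
    have "(\<Sum>t\<in>S. cinner v t * cinner t s) = (\<Sum>t\<in>S. if t = s then cinner v s else 0)"
      using S that by (intro sum.cong) (auto simp: orthonormal_def cinner_self)
    then show ?thesis
      using that S by (simp add: w_def cinner_diff_left cinner_sum_left cinner_scaleC_left)
  qed
  then have orth: "cinner e s = 0" if "s \<in> S" for s
    using that by (simp add: e_def cinner_scaleC_left)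
  then have orth': "cinner s e = 0" if "s \<in> S" for s
    using that by (subst cinner_commute) simp
  \<comment> \<open>Membership would make \<open>e\<close> orthogonal to itself, against its norm
    being 1.\<close>
  have "e \<notin> S"
    using orth[of e] ne by (auto simp: cinner_self)
  moreover have "orthonormal (insert e S)"
    using S ne orth orth' by (auto simp: orthonormal_def)
  ultimately show thesis
    using that by blast
qed

text \<open>A finite spanning set puts \<open>cdimension\<close> in its finite branch and bounds it
  by the cardinality. This treats finite and infinite dimension at once.\<close>

lemma cspan_neq_UNIV:
  fixes S :: "'a::chilbert_space set"
  assumes "finite S" "enat (card S) < cdimension TYPE('a)"
  shows "cspan S \<noteq> UNIV"
proof
  assume span: "cspan S = UNIV"
  then have "cdim (UNIV :: 'a set) \<le> card S"
    using assms(1) by (intro complex_vector.dim_le_card) auto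
  moreover have "cdimension TYPE('a) = enat (cdim (UNIV :: 'a set))"
    using span assms(1) by (auto simp: cdimension_def)
  ultimately show False
    using assms(2) by simp
qed

lemma ex_orthonormal_set:
  assumes "enat n \<le> cdimension TYPE('a::chilbert_space)"
  shows "\<exists>S :: 'a set. finite S \<and> card S = n \<and> orthonormal S"
  using assms
proof (induction n)
  case 0
  show ?case
    by (rule exI[of _ "{}"]) (simp add: orthonormal_def)
next
  case (Suc n)
  \<comment> \<open>Strictness is what leaves room for one more vector: \<open>n\<close> vectors
    cannot span.\<close>
  have less: "enat n < cdimension TYPE('a)"
    using Suc.prems by (simp add: Suc_ile_eq)
  obtain S :: "'a set" where S: "finite S" "card S = n" "orthonormal S"
    using Suc.IH[OF order_less_imp_le[OF less]] by blast
  then obtain e where "e \<notin> S" "orthonormal (insert e S)"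
    using orthonormal_extend cspan_neq_UNIV less by metis
  then show ?case
    using S by (intro exI[of _ "insert e S"]) simp
qed

lemma bounded_clinear_rank_one:
  fixes e f :: "'a::chilbert_space"
  assumes "norm e = 1"
  shows "bounded_clinear (\<lambda>x. cinner x e *\<^sub>C f)"
  unfolding bounded_clinear_def
proof
  show "Vector_Spaces.linear (*\<^sub>C) (*\<^sub>C) (\<lambda>x. cinner x e *\<^sub>C f)"
    by unfold_locales
      (simp_all add: cinner_add_left cinner_scaleC_left scaleC_add_left scaleC_scaleC)
  have "norm (cinner x e *\<^sub>C f) \<le> norm f * norm x" for x
    using mult_right_mono[OF cmod_cinner_le_norm[OF assms] norm_ge_zero]
    by (simp add: norm_scaleC mult.commute)
  then show "\<exists>K. \<forall>x. norm (cinner x e *\<^sub>C f) \<le> K * norm x"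
    by blast
qed

theorem theorem2p2:
  assumes "4 \<le> cdimension TYPE('a::chilbert_space)"
  shows "\<exists>T1 T2 T3 :: 'a \<Rightarrow> 'a.
    bounded_clinear T1 \<and> bounded_clinear T2 \<and> bounded_clinear T3 \<and>
    T1 \<circ> T2 = T2 \<circ> T1 \<and> T1 \<circ> T3 = T3 \<circ> T1 \<and> T2 \<circ> T3 = T3 \<circ> T2 \<and>
    \<not> convex (AP_range (T1, T2, T3))"
proof -
  have "enat 4 \<le> cdimension TYPE('a)"
    using assms by (simp add: numeral_eq_enat)
  then obtain S :: "'a set" where S: "card S = 4" "orthonormal S"
    using ex_orthonormal_set by blast
  obtain a b c d where "S = {a, b, c, d}" and distinct: "distinct [a, b, c, d]"
    using S(1) by (auto simp: card_Suc_eq numeral_eq_Suc)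
  with S(2) have norm1: "norm a = 1" "norm b = 1" "norm c = 1" "norm d = 1"
    and orth: "cinner a b = 0" "cinner c d = 0" "cinner d c = 0" "cinner b a = 0"
      "cinner c a = 0" "cinner c b = 0" "cinner d a = 0" "cinner d b = 0"
    by (auto simp: orthonormal_def)
  define T1 T2 T3 where T_defs:
    "T1 = (\<lambda>x. cinner x a *\<^sub>C c)" "T2 = (\<lambda>x. cinner x b *\<^sub>C d)" "T3 = (\<lambda>x. cinner x a *\<^sub>C d)"
  have bounded: "bounded_clinear T1" "bounded_clinear T2" "bounded_clinear T3"
    unfolding T_defs by (intro bounded_clinear_rank_one norm1)+
  \<comment> \<open>Each range lies in the span of \<open>c\<close> and \<open>d\<close>, where the
    functionals given by \<open>a\<close> and \<open>b\<close> vanish; so both sides are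
    zero.\<close>
  have commute: "T1 \<circ> T2 = T2 \<circ> T1" "T1 \<circ> T3 = T3 \<circ> T1" "T2 \<circ> T3 = T3 \<circ> T2"
    by (simp_all add: T_defs fun_eq_iff cinner_scaleC_left orth)
  let ?W = "AP_range (T1, T2, T3)"
  have W: "p \<in> ?W \<longleftrightarrow> (\<exists>x y. p = (cinner x a * cinner c y, cinner x b * cinner d y,
      cinner x a * cinner d y) \<and> norm x \<le> 1 \<and> norm y \<le> 1)" for p
    by (simp add: AP_range_def T_defs cinner_scaleC_left)
  have "\<not> convex ?W"
  proof
    assume conv: "convex ?W"
    have "(1, 0, 0) \<in> ?W"
      unfolding W by (intro exI[of _ a] exI[of _ c]) (simp add: cinner_self norm1 orth)
    moreover have "(0, 1, 0) \<in> ?W"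
      unfolding W by (intro exI[of _ b] exI[of _ d]) (simp add: cinner_self norm1 orth)
    ultimately have "(1/2) *\<^sub>R (1, 0, 0) + (1/2) *\<^sub>R (0, 1, 0) \<in> ?W"
      by (intro convexD[OF conv]) auto
    \<comment> \<open>At \<open>(1/2, 1/2, 0)\<close> the third coordinate forces
      \<open>cinner x a = 0\<close>, against the first, or \<open>cinner d y = 0\<close>, against
      the second.\<close>
    then show False
      unfolding W by (auto simp: scaleR_conv_of_real)
  qed
  with bounded commute show ?thesis
    by blast
qed

end
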